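(* Let $P\ge1$, $r_1,\dots,r_P\ge1$, $m_1,\dots,m_P\ge2$, $\eta_1,\eta_2,T\ge1$ be integers and $r=\sum_{p=1}^Pr_p\ge2$. The hypercuboid coded distributed computing scheme with these parameters (Node Grouping 2, NG File Mapping, Function Assignment 2 and the NG Shuffle Method) is correct, that is: (1) each node only computes intermediate values (IVs) from files available to it; (2) in the Shuffle phase each node only transmits messages formed from IVs it has computed; (3) from each multicast message it receives, a node can decode the segment intended for it, using the IVs it has computed itself; and (4) after the Map and Shuffle phases every node $k\in[K]$ has all the IVs $v_{i,j}$, $i\in\mathcal W_k$, $j\in[N]$, needed to compute its assigned reduce functions.
   Context: Model. There are $K$ nodes $[K]=\{1,\dots,K\}$, $N$ input files $w_1,\dots,w_N$ and $Q$ output (reduce) functions. For $i\in[Q]$, $j\in[N]$ there is an intermediate value (IV) $v_{i,j}\in\{0,1\}^T$, computed from file $w_j$ alone; function $i$ can be computed from $v_{i,1},\dots,v_{i,N}$. Node $k$ stores a set of files $\mathcal M_k$ and must compute the functions in $\mathcal W_k\subseteq[Q]$. In the Map phase node $k$ computes all IVs $v_{i,j}$ with $i\in[Q]$, $w_j\in\mathcal M_k$. In the Shuffle phase nodes multicast messages to each other over a shared link. Node Grouping 2. The node set $[K]$ is partitioned into $\mathcal C_1,\dots,\mathcal C_P$, and each $\mathcal C_p$ is partitioned into $r_p$ subsets of size $m_p$; so $K=\sum_pr_pm_p$. Altogether this gives $r=\sum_pr_p$ sets $\mathcal K_1,\dots,\mathcal K_r$ partitioning $[K]$ (those numbered $r_1+\dots+r_{p-1}+1,\dots,r_1+\dots+r_p$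 partition $\mathcal C_p$). A node group is a set of $r$ nodes containing exactly one node from each $\mathcal K_i$, $i\in[r]$; there are $X=\prod_{p=1}^Pm_p^{r_p}$ node groups $\mathcal T_1,\dots,\mathcal T_X$; $\mathcal T_{j,i}$ denotes the unique node in $\mathcal T_j\cap\mathcal K_i$. NG File Mapping. $N=\eta_1X$; the files are partitioned into sets $\mathcal B_1,\dots,\mathcal B_X$ of size $\eta_1$, and $\mathcal M_k=\bigcup_{i:\,k\in\mathcal T_i}\mathcal B_i$. Function Assignment 2. Let $Y$ be the least common multiple of $m_1-1,\dots,m_P-1$. Then $Q=\eta_2Y\sum_{p=1}^P\frac{r_pm_p}{m_p-1}$, and $[Q]$ is partitioned into $\mathcal W_1,\dots,\mathcal W_K$ with $|\mathcal W_k|=\frac{\eta_2Y}{m_p-1}$ for $k\in\mathcal C_p$. NG Shuffle Method. For $\alpha\in[X]$ and $z\in\mathcal T_\alpha$ with $z\in\mathcal K_h$, let $$\mathcal L_{z,\alpha}=\{\ell\in[X]:\mathcal T_{\ell,h}\neq z,\ \mathcal T_{\ell,i}=\mathcal T_{\alpha,i}\ \forall i\in[r]\setminus\{h\}\},$$ $$\mathcal V^{\{z\}}_{\mathcal T_\alpha\setminus z}=\bigcup_{\ell\in\mathcal L_{z,\alpha}}\{v_{i,j}: i\in\mathcal W_z,\ w_j\in\mathcal B_\ell\}.$$ The IVs of $\mathcal V^{\{z\}}_{\mathcal T_\alpha\setminus z}$ are concatenated (in a fixed known order) into one bit string, which is split into $r-1$ segments of equal length, denoted $\mathcal V^{\{z\},\sigma}_{\mathcal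 T_\alpha\setminus z}$ and indexed by $\sigma\in\mathcal T_\alpha\setminus\{z\}$ (it is assumed that $T$ is such that the bit length is divisible by $r-1$). For every $\alpha\in[X]$ and every $k\in\mathcal T_\alpha$, node $k$ multicasts the bitwise XOR $\bigoplus_{z\in\mathcal T_\alpha\setminus\{k\}}\mathcal V^{\{z\},k}_{\mathcal T_\alpha\setminus z}$ to the nodes of $\mathcal T_\alpha\setminus\{k\}$; the segment of this message intended for node $z\in\mathcal T_\alpha\setminus\{k\}$ is $\mathcal V^{\{z\},k}_{\mathcal T_\alpha\setminus z}$. *)

theory Defs
  imports Complex_Main "HOL-Library.Disjoint_Sets"
begin

text \<open>
  A record collects the numerical parameters and all the arbitrary choices made when the scheme is
  set up.  Nodes, files and functions are the numbers from 1 to K, N and Q; an intermediate value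
  (IV) is identified by the pair (i, j) of its function and its file.
\<close>

record hc_scheme =
  nclasses :: nat                                 \<comment> \<open>$P$\<close>
  rdim :: "nat \<Rightarrow> nat"                             \<comment> \<open>$r_p$\<close>
  msize :: "nat \<Rightarrow> nat"                            \<comment> \<open>$m_p$\<close>
  eta1 :: nat
  eta2 :: nat
  ivbits :: nat                                   \<comment> \<open>$T$\<close>
  nfuns :: nat                                    \<comment> \<open>$Q$\<close>
  node_class :: "nat \<Rightarrow> nat set"                   \<comment> \<open>$\mathcal C_p$\<close>
  node_part :: "nat \<Rightarrow> nat set"                    \<comment> \<open>$\mathcal K_i$\<close>
  node_group :: "nat \<Rightarrow> nat set"                   \<comment> \<open>$\mathcal T_\alpha$\<close>
  file_batch :: "nat \<Rightarrow> nat set"                   \<comment> \<open>$\mathcal B_\alpha$\<close>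
  funs_of :: "nat \<Rightarrow> nat set"                      \<comment> \<open>$\mathcal W_k$\<close>
  iv_order :: "nat \<Rightarrow> nat \<Rightarrow> (nat \<times> nat) list"     \<comment> \<open>concatenation order for $z$, $\alpha$\<close>
  seg_pos :: "nat \<Rightarrow> nat \<Rightarrow> nat \<Rightarrow> nat"            \<comment> \<open>position of segment $\sigma$ for $z$, $\alpha$\<close>

definition indexed_partition :: "nat set \<Rightarrow> (nat \<Rightarrow> nat set) \<Rightarrow> nat set \<Rightarrow> bool" where
  "indexed_partition I F A \<longleftrightarrow>
     (\<Union>i\<in>I. F i) = A \<and> disjoint_family_on F I \<and> (\<forall>i\<in>I. F i \<noteq> {})"


subsection \<open>Node Grouping 2\<close>

definition num_nodes :: "hc_scheme \<Rightarrow> nat" where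
  "num_nodes S = (\<Sum>p = 1..nclasses S. rdim S p * msize S p)"

definition num_parts :: "hc_scheme \<Rightarrow> nat" where
  "num_parts S = (\<Sum>p = 1..nclasses S. rdim S p)"

definition num_groups :: "hc_scheme \<Rightarrow> nat" where
  "num_groups S = (\<Prod>p = 1..nclasses S. msize S p ^ rdim S p)"

definition class_parts :: "hc_scheme \<Rightarrow> nat \<Rightarrow> nat set" where
  "class_parts S p = {(\<Sum>q = 1..<p. rdim S q) + 1 .. (\<Sum>q = 1..p. rdim S q)}"

definition is_node_group :: "hc_scheme \<Rightarrow> nat set \<Rightarrow> bool" where
  "is_node_group S G \<longleftrightarrow>
     G \<subseteq> {1..num_nodes S} \<and> card G = num_parts S \<and>
     (\<forall>i\<in>{1..num_parts S}. \<exists>!k. k \<in> G \<inter> node_part S i)"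

definition node_grouping2 :: "hc_scheme \<Rightarrow> bool" where
  "node_grouping2 S \<longleftrightarrow>
     indexed_partition {1..nclasses S} (node_class S) {1..num_nodes S} \<and>
     (\<forall>p\<in>{1..nclasses S}.
        indexed_partition (class_parts S p) (node_part S) (node_class S p) \<and>
        (\<forall>i\<in>class_parts S p. card (node_part S i) = msize S p)) \<and>
     bij_betw (node_group S) {1..num_groups S} {G. is_node_group S G}"

definition group_node :: "hc_scheme \<Rightarrow> nat \<Rightarrow> nat \<Rightarrow> nat" where
  "group_node S j i = (THE k. k \<in> node_group S j \<inter> node_part S i)"


subsection \<open>NG File Mapping\<close>

definition num_files :: "hc_scheme \<Rightarrow> nat" where
  "num_files S = eta1 S * num_groups S"

definition ng_file_mapping :: "hc_scheme \<Rightarrow> bool" where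
  "ng_file_mapping S \<longleftrightarrow>
     indexed_partition {1..num_groups S} (file_batch S) {1..num_files S} \<and>
     (\<forall>j\<in>{1..num_groups S}. card (file_batch S j) = eta1 S)"

definition files_at :: "hc_scheme \<Rightarrow> nat \<Rightarrow> nat set" where
  "files_at S k = (\<Union>j\<in>{j\<in>{1..num_groups S}. k \<in> node_group S j}. file_batch S j)"


subsection \<open>Function Assignment 2\<close>

definition lcmY :: "hc_scheme \<Rightarrow> nat" where
  "lcmY S = Lcm ((\<lambda>p. msize S p - 1) ` {1..nclasses S})"

definition function_assignment2 :: "hc_scheme \<Rightarrow> bool" where
  "function_assignment2 S \<longleftrightarrow>
     real (nfuns S) = real (eta2 S) * real (lcmY S) *
       (\<Sum>p = 1..nclasses S. real (rdim S p) * real (msize S p) / (real (msize S p) - 1)) \<and>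
     indexed_partition {1..num_nodes S} (funs_of S) {1..nfuns S} \<and>
     (\<forall>p\<in>{1..nclasses S}. \<forall>k\<in>node_class S p.
        real (card (funs_of S k)) = real (eta2 S) * real (lcmY S) / (real (msize S p) - 1))"


subsection \<open>Files, intermediate values and the Map phase\<close>

text \<open>
  The contents of the files are \<open>w :: nat \<Rightarrow> 'f\<close>, and the IV for function i and file j is obtained
  from file j alone by the map function \<open>g i j\<close>, which is fixed and public.
\<close>

definition map_functions :: "hc_scheme \<Rightarrow> (nat \<Rightarrow> nat \<Rightarrow> 'f \<Rightarrow> bool list) \<Rightarrow> bool" where
  "map_functions S g \<longleftrightarrow>
     (\<forall>i\<in>{1..nfuns S}. \<forall>j\<in>{1..num_files S}. \<forall>x. length (g i j x) = ivbits S)"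

definition iv :: "(nat \<Rightarrow> nat \<Rightarrow> 'f \<Rightarrow> bool list) \<Rightarrow> (nat \<Rightarrow> 'f) \<Rightarrow> nat \<Rightarrow> nat \<Rightarrow> bool list" where
  "iv g w i j = g i j (w j)"

definition stored_files :: "hc_scheme \<Rightarrow> (nat \<Rightarrow> 'f) \<Rightarrow> nat \<Rightarrow> (nat \<rightharpoonup> 'f)" where
  "stored_files S w k = (\<lambda>j. if j \<in> files_at S k then Some (w j) else None)"

definition computed :: "hc_scheme \<Rightarrow> nat \<Rightarrow> (nat \<times> nat) set" where
  "computed S k = {(i, j). i \<in> {1..nfuns S} \<and> j \<in> files_at S k}"

definition map_output ::
  "hc_scheme \<Rightarrow> (nat \<Rightarrow> nat \<Rightarrow> bool list) \<Rightarrow> nat \<Rightarrow> (nat \<times> nat \<rightharpoonup> bool list)" where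
  "map_output S v k = (\<lambda>(i, j). if (i, j) \<in> computed S k then Some (v i j) else None)"


subsection \<open>NG Shuffle Method\<close>

text \<open>The h below is unique, since the parts are disjoint.\<close>

definition neighbours :: "hc_scheme \<Rightarrow> nat \<Rightarrow> nat \<Rightarrow> nat set" where
  "neighbours S z \<alpha> = {l \<in> {1..num_groups S}. \<exists>h\<in>{1..num_parts S}. z \<in> node_part S h \<and>
     group_node S l h \<noteq> z \<and>
     (\<forall>i\<in>{1..num_parts S} - {h}. group_node S l i = group_node S \<alpha> i)}"

definition iv_set :: "hc_scheme \<Rightarrow> nat \<Rightarrow> nat \<Rightarrow> (nat \<times> nat) set" where
  "iv_set S z \<alpha> = (\<Union>l\<in>neighbours S z \<alpha>. funs_of S z \<times> file_batch S l)"

definition iv_string :: "hc_scheme \<Rightarrow> (nat \<Rightarrow> nat \<Rightarrow> bool list) \<Rightarrow> nat \<Rightarrow> nat \<Rightarrow> bool list" where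
  "iv_string S v z \<alpha> = concat (map (\<lambda>(i, j). v i j) (iv_order S z \<alpha>))"

definition shuffle_setup :: "hc_scheme \<Rightarrow> bool" where
  "shuffle_setup S \<longleftrightarrow>
     (\<forall>\<alpha>\<in>{1..num_groups S}. \<forall>z\<in>node_group S \<alpha>.
        distinct (iv_order S z \<alpha>) \<and> set (iv_order S z \<alpha>) = iv_set S z \<alpha> \<and>
        bij_betw (seg_pos S z \<alpha>) (node_group S \<alpha> - {z}) {..<num_parts S - 1} \<and>
        (num_parts S - 1) dvd (ivbits S * card (iv_set S z \<alpha>)))"

definition segment ::
  "hc_scheme \<Rightarrow> (nat \<Rightarrow> nat \<Rightarrow> bool list) \<Rightarrow> nat \<Rightarrow> nat \<Rightarrow> nat \<Rightarrow> bool list" where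
  "segment S v z \<alpha> \<sigma> =
     (let len = length (iv_string S v z \<alpha>) div (num_parts S - 1)
      in take len (drop (seg_pos S z \<alpha> \<sigma> * len) (iv_string S v z \<alpha>)))"

text \<open>
  Bitwise XOR of a finite nonempty family of bit strings.  Strings of different lengths would be
  truncated; that this never happens is part of the correctness claim.
\<close>

definition xor_family :: "nat set \<Rightarrow> (nat \<Rightarrow> bool list) \<Rightarrow> bool list" where
  "xor_family A f =
     map (\<lambda>b. odd (card {z\<in>A. f z ! b})) [0..<Min ((\<lambda>z. length (f z)) ` A)]"

definition message ::
  "hc_scheme \<Rightarrow> (nat \<Rightarrow> nat \<Rightarrow> bool list) \<Rightarrow> nat \<Rightarrow> nat \<Rightarrow> bool list" where
  "message S v \<alpha> k = xor_family (node_group S \<alpha> - {k}) (\<lambda>z. segment S v z \<alpha> k)"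

text \<open>All messages that reach node z, indexed by the group and the sender.\<close>

definition received ::
  "hc_scheme \<Rightarrow> (nat \<Rightarrow> nat \<Rightarrow> bool list) \<Rightarrow> nat \<Rightarrow> (nat \<times> nat \<rightharpoonup> bool list)" where
  "received S v z = (\<lambda>(\<alpha>, k).
     if \<alpha> \<in> {1..num_groups S} \<and> k \<in> node_group S \<alpha> \<and> z \<in> node_group S \<alpha> - {k}
     then Some (message S v \<alpha> k) else None)"


subsection \<open>Correctness\<close>

text \<open>
  That a node can produce some data from what it knows means that there is a fixed function which
  yields the data from that knowledge for all possible contents \<open>w\<close> of the files.
\<close>

definition maps_own_files ::
  "hc_scheme \<Rightarrow> (nat \<Rightarrow> nat \<Rightarrow> 'f \<Rightarrow> bool list) \<Rightarrow> bool" where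
  "maps_own_files S g \<longleftrightarrow>
     (\<forall>k\<in>{1..num_nodes S}.
        (\<forall>(i, j)\<in>computed S k. j \<in> files_at S k) \<and>
        (\<exists>mapper. \<forall>w. map_output S (iv g w) k = mapper (stored_files S w k)))"

definition sends_own_ivs ::
  "hc_scheme \<Rightarrow> (nat \<Rightarrow> nat \<Rightarrow> 'f \<Rightarrow> bool list) \<Rightarrow> bool" where
  "sends_own_ivs S g \<longleftrightarrow>
     (\<forall>\<alpha>\<in>{1..num_groups S}. \<forall>k\<in>node_group S \<alpha>.
        (\<forall>z\<in>node_group S \<alpha> - {k}. iv_set S z \<alpha> \<subseteq> computed S k) \<and>
        (\<forall>w. \<forall>z\<in>node_group S \<alpha> - {k}. \<forall>z'\<in>node_group S \<alpha> - {k}.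
           length (segment S (iv g w) z \<alpha> k) = length (segment S (iv g w) z' \<alpha> k)) \<and>
        (\<exists>encoder. \<forall>w. message S (iv g w) \<alpha> k = encoder (map_output S (iv g w) k)))"

definition decodes_segments ::
  "hc_scheme \<Rightarrow> (nat \<Rightarrow> nat \<Rightarrow> 'f \<Rightarrow> bool list) \<Rightarrow> bool" where
  "decodes_segments S g \<longleftrightarrow>
     (\<forall>\<alpha>\<in>{1..num_groups S}. \<forall>k\<in>node_group S \<alpha>. \<forall>z\<in>node_group S \<alpha> - {k}.
        \<exists>decoder. \<forall>w.
          segment S (iv g w) z \<alpha> k =
            decoder (map_output S (iv g w) z) (message S (iv g w) \<alpha> k))"

definition has_needed_ivs ::
  "hc_scheme \<Rightarrow> (nat \<Rightarrow> nat \<Rightarrow> 'f \<Rightarrow> bool list) \<Rightarrow> bool" where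
  "has_needed_ivs S g \<longleftrightarrow>
     (\<forall>k\<in>{1..num_nodes S}. \<exists>recover. \<forall>w. \<forall>i\<in>funs_of S k. \<forall>j\<in>{1..num_files S}.
        iv g w i j = recover (map_output S (iv g w) k) (received S (iv g w) k) i j)"

end

theory Submission
  imports Defs
begin

text \<open>
  The node groups are the points of a hypercuboid grid whose axes are the parts of the node set.
  Replacing one coordinate of a group yields a group again, so \<open>l\<close> neighbours \<open>\<alpha>\<close> along the axis
  of \<open>z\<close> exactly when \<open>l\<close> arises from \<open>\<alpha>\<close> by exchanging \<open>z\<close>.  Hence every other node
  of the group \<open>\<alpha>\<close> stores the files of \<open>l\<close>, which makes messages computable and interference
  cancellable.  There are $m_p - 1$ such neighbours, which cancels the denominator in the number of
  functions of \<open>z\<close>: all strings exchanged within a group have the same length.  Finally, a file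
  batch \<open>l\<close> not stored at \<open>k\<close> is delivered in the group obtained from \<open>l\<close> by
  exchanging the node in the part of \<open>k\<close> for \<open>k\<close>.

  That data can be produced from some knowledge is shown as functional dependence: whenever two file
  contents lead to the same knowledge, they lead to the same data.
\<close>

section \<open>Functional dependence, bit strings and consecutive intervals\<close>

lemma ex_function_of_iff:
  "(\<exists>d. \<forall>w. f w = d (a w)) \<longleftrightarrow> (\<forall>w w'. a w = a w' \<longrightarrow> f w = f w')"
proof
  assume R: "\<forall>w w'. a w = a w' \<longrightarrow> f w = f w'"
  \<comment> \<open>The witness evaluates \<open>f\<close> at an arbitrary input compatible with the
    observed knowledge; by \<open>R\<close> the choice is irrelevant.\<close>
  have "f w = f (SOME w'. a w' = a w)" for w
    using R someI[of "\<lambda>w'. a w' = a w" w] by metis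
  then show "\<exists>d. \<forall>w. f w = d (a w)"
    by (intro exI[of _ "\<lambda>y. f (SOME w'. a w' = y)"]) blast
qed metis

lemma length_concat_map_const:
  assumes "\<And>x. x \<in> set xs \<Longrightarrow> length (f x) = n"
  shows "length (concat (map f xs)) = n * length xs"
  using assms by (induction xs) auto

text \<open>Equal lengths place the block boundaries of both concatenations at the same positions,
  so the blocks can be compared one by one.\<close>

lemma concat_map_eqD:
  assumes "concat (map f xs) = concat (map f' xs)"
    and "\<And>x. x \<in> set xs \<Longrightarrow> length (f x) = length (f' x)" and "x \<in> set xs"
  shows "f x = f' x"
  using assms by (induction xs) auto

text \<open>Used to reassemble an IV string from its segments.\<close>

lemma eq_if_blocks_eq:
  assumes "length xs = n * len" and "length ys = n * len"
    and "\<And>i. i < n \<Longrightarrow> take len (drop (i * len) xs) = take len (drop (i * len) ys)"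
  shows "xs = ys"
  using assms
proof (induction n arbitrary: xs ys)
  case (Suc n)
  have "take len (drop (i * len) (drop len xs)) = take len (drop (i * len) (drop len ys))"
    if "i < n" for i
    using Suc.prems(3)[of "Suc i"] that by (simp add: add.commute)
  then have "drop len xs = drop len ys"
    using Suc.IH[of "drop len xs" "drop len ys"] Suc.prems(1,2) by simp
  moreover have "take len xs = take len ys"
    using Suc.prems(3)[of 0] by simp
  ultimately show ?case
    by (metis append_take_drop_id)
qed auto

text \<open>Each bit of the XOR is the bit of \<open>z\<close> XORed with the parity of the
  remaining bits, and that parity is the same on both sides. The common length \<open>n\<close>
  ensures that no bit is lost to truncation.\<close>

lemma xor_family_cancel:
  assumes "finite A" and "z \<in> A"
    and len: "\<And>y. y \<in> A \<Longrightarrow> length (f y) = n" "\<And>y. y \<in> A \<Longrightarrow> length (f' y) = n"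
    and eq: "xor_family A f = xor_family A f'"
    and others: "\<And>y. y \<in> A - {z} \<Longrightarrow> f y = f' y"
  shows "f z = f' z"
proof (rule nth_equalityI)
  show "length (f z) = length (f' z)"
    using len \<open>z \<in> A\<close> by simp
  fix b assume "b < length (f z)"
  then have b: "b < n"
    using len \<open>z \<in> A\<close> by simp
  have bit: "xor_family A h ! b \<longleftrightarrow> (h z ! b \<noteq> odd (card {y \<in> A - {z}. h y ! b}))"
    if "\<And>y. y \<in> A \<Longrightarrow> length (h y) = n" for h
  proof -
    have "(\<lambda>y. length (h y)) ` A = {n}"
      using that \<open>z \<in> A\<close> by force
    then have "xor_family A h ! b \<longleftrightarrow> odd (card {y \<in> A. h y ! b})"
      using b by (simp add: xor_family_def)
    moreover have "{y \<in> A. h y ! b} =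
        (if h z ! b then insert z {y \<in> A - {z}. h y ! b} else {y \<in> A - {z}. h y ! b})"
      using \<open>z \<in> A\<close> by auto
    ultimately show ?thesis
      using \<open>finite A\<close> by auto
  qed
  have "{y \<in> A - {z}. f y ! b} = {y \<in> A - {z}. f' y ! b}"
    using others by auto
  then show "f z ! b = f' z ! b"
    using bit[of f, OF len(1)] bit[of f', OF len(2)] eq by auto
qed

text \<open>The intervals are consecutive: each starts right after the sum at which the preceding
  one ends.\<close>

lemma UN_class_parts: "(\<Union>p\<in>{1..n}. class_parts S p) = {1..\<Sum>p = 1..n. rdim S p}"
proof (induction n)
  case (Suc n)
  have "class_parts S (Suc n) = {(\<Sum>p = 1..n. rdim S p) + 1..(\<Sum>p = 1..Suc n. rdim S p)}"
    by (simp only: class_parts_def atLeastLessThanSuc_atLeastAtMost)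
  moreover have "{1..Suc n} = insert (Suc n) {1..n}"
    by auto
  ultimately show ?case
    using Suc.IH by auto
qed simp

section \<open>The Map phase\<close>

lemma maps_own_files: "maps_own_files S g"
proof -
  have "map_output S (iv g w) k = map_output S (iv g w') k"
    if "stored_files S w k = stored_files S w' k" for w w' k
  proof -
    \<comment> \<open>A defined entry \<open>Some (w j)\<close> reveals the content of file
      \<open>j\<close>, and an IV of file \<open>j\<close> reads no other file.\<close>
    have "w j = w' j" if "j \<in> files_at S k" for j
      using fun_cong[OF \<open>stored_files S w k = _\<close>, of j] that by (simp add: stored_files_def)
    then show ?thesis
      by (auto simp: map_output_def iv_def computed_def fun_eq_iff)
  qed
  then show ?thesis
    unfolding maps_own_files_def ex_function_of_iff computed_def by blast
qed

lemma map_output_eq_iff: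
  "map_output S v k = map_output S v' k \<longleftrightarrow> (\<forall>(i, j)\<in>computed S k. v i j = v' i j)"
  by (auto simp: map_output_def fun_eq_iff)

section \<open>The partition of the nodes into parts\<close>

locale hypercuboid_scheme =
  fixes S :: hc_scheme
  assumes msize: "p \<in> {1..nclasses S} \<Longrightarrow> msize S p \<ge> 2"
    and grouping: "node_grouping2 S"
    and mapping: "ng_file_mapping S"
    and assignment: "function_assignment2 S"
    and shuffle: "shuffle_setup S"
begin

abbreviation "groups \<equiv> {1..num_groups S}"
abbreviation "parts \<equiv> {1..num_parts S}"
abbreviation "nodes \<equiv> {1..num_nodes S}"

lemma part_in_class:
  assumes "i \<in> parts"
  obtains p where "p \<in> {1..nclasses S}" "i \<in> class_parts S p" "node_part S i \<subseteq> node_class S p"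
    "card (node_part S i) = msize S p"
proof -
  have "i \<in> (\<Union>p\<in>{1..nclasses S}. class_parts S p)"
    using assms by (simp only: UN_class_parts num_parts_def)
  then show thesis
    using that grouping by (fastforce simp: node_grouping2_def indexed_partition_def)
qed

lemma part_subset_nodes:
  assumes "i \<in> parts" shows "node_part S i \<subseteq> nodes"
proof -
  obtain p where "p \<in> {1..nclasses S}" "node_part S i \<subseteq> node_class S p"
    using part_in_class[OF assms] by blast
  then show ?thesis
    using grouping unfolding node_grouping2_def indexed_partition_def by blast
qed

lemma node_in_part:
  assumes "k \<in> nodes"
  obtains i where "i \<in> parts" "k \<in> node_part S i"
proof -
  have "k \<in> (\<Union>p\<in>{1..nclasses S}. node_class S p)"
    using assms grouping unfolding node_grouping2_def indexed_partition_def by blast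
  then obtain p where p: "p \<in> {1..nclasses S}" "k \<in> node_class S p"
    by blast
  then have "k \<in> (\<Union>i\<in>class_parts S p. node_part S i)"
    using grouping unfolding node_grouping2_def indexed_partition_def by blast
  then obtain i where i: "i \<in> class_parts S p" "k \<in> node_part S i"
    by blast
  have "i \<in> (\<Union>p\<in>{1..nclasses S}. class_parts S p)"
    using i p by blast
  then have "i \<in> parts"
    by (simp only: UN_class_parts num_parts_def)
  then show thesis
    using i that by blast
qed

text \<open>Disjointness is used at two levels: first the classes containing the parts must
  coincide, then the parts within that class.\<close>

lemma part_unique:
  assumes "i \<in> parts" "i' \<in> parts" "k \<in> node_part S i" "k \<in> node_part S i'"
  shows "i = i'"
proof -
  obtain p where p: "p \<in> {1..nclasses S}" "i \<in> class_parts S p" "node_part S i \<subseteq> node_class S p"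
    using part_in_class[OF assms(1)] by blast
  obtain p' where p': "p' \<in> {1..nclasses S}" "i' \<in> class_parts S p'"
    "node_part S i' \<subseteq> node_class S p'"
    using part_in_class[OF assms(2)] by blast
  have "disjoint_family_on (node_class S) {1..nclasses S}"
    using grouping by (simp add: node_grouping2_def indexed_partition_def)
  then have "p = p'"
    using p p' assms(3,4) unfolding disjoint_family_on_def by blast
  moreover have "disjoint_family_on (node_part S) (class_parts S p)"
    using grouping p by (simp add: node_grouping2_def indexed_partition_def)
  ultimately show ?thesis
    using p p' assms(3,4) unfolding disjoint_family_on_def by blast
qed

section \<open>Node groups as points of a grid\<close>

lemma is_group: "\<alpha> \<in> groups \<Longrightarrow> is_node_group S (node_group S \<alpha>)"
  using grouping by (auto simp: node_grouping2_def dest: bij_betwE)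

lemma group_index:
  assumes "is_node_group S G"
  obtains \<alpha> where "\<alpha> \<in> groups" "node_group S \<alpha> = G"
proof -
  have "G \<in> node_group S ` groups"
    using assms grouping by (simp add: node_grouping2_def bij_betw_def)
  then show thesis
    using that by blast
qed

lemma group_subset_nodes: "\<alpha> \<in> groups \<Longrightarrow> node_group S \<alpha> \<subseteq> nodes"
  using is_group by (simp add: is_node_group_def)

lemma finite_group: "\<alpha> \<in> groups \<Longrightarrow> finite (node_group S \<alpha>)"
  using group_subset_nodes finite_subset by blast

lemma group_node_mem:
  assumes "\<alpha> \<in> groups" "i \<in> parts"
  shows "group_node S \<alpha> i \<in> node_group S \<alpha>" "group_node S \<alpha> i \<in> node_part S i"
proof -
  have "\<exists>!k. k \<in> node_group S \<alpha> \<inter> node_part S i"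
    using is_group[OF assms(1)] assms(2) by (simp add: is_node_group_def)
  from theI'[OF this] show "group_node S \<alpha> i \<in> node_group S \<alpha>" "group_node S \<alpha> i \<in> node_part S i"
    by (auto simp: group_node_def)
qed

lemma group_node_eq:
  assumes "\<alpha> \<in> groups" "i \<in> parts" "k \<in> node_group S \<alpha>" "k \<in> node_part S i"
  shows "group_node S \<alpha> i = k"
proof -
  have "\<exists>!k. k \<in> node_group S \<alpha> \<inter> node_part S i"
    using is_group[OF assms(1)] assms(2) by (simp add: is_node_group_def)
  then show ?thesis
    using group_node_mem[OF assms(1,2)] assms(3,4) by blast
qed

lemma node_group_eq_image:
  assumes "\<alpha> \<in> groups" shows "node_group S \<alpha> = group_node S \<alpha> ` parts"
proof
  show "node_group S \<alpha> \<subseteq> group_node S \<alpha> ` parts"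
  proof
    fix k assume k: "k \<in> node_group S \<alpha>"
    then obtain i where "i \<in> parts" "k \<in> node_part S i"
      using node_in_part group_subset_nodes[OF assms] by blast
    then show "k \<in> group_node S \<alpha> ` parts"
      using group_node_eq[OF assms _ k] by blast
  qed
qed (use group_node_mem assms in blast)

text \<open>The coordinates determine the node set of a group, because every node lies in some part;
  the enumeration of the groups is injective.\<close>

lemma group_eqI:
  assumes "\<alpha> \<in> groups" "\<beta> \<in> groups"
    and "\<And>i. i \<in> parts \<Longrightarrow> group_node S \<alpha> i = group_node S \<beta> i"
  shows "\<alpha> = \<beta>"
proof -
  have "node_group S \<alpha> = node_group S \<beta>"
    using assms node_group_eq_image by (metis image_cong)
  moreover have "inj_on (node_group S) groups"
    using grouping by (simp add: node_grouping2_def bij_betw_def)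
  ultimately show ?thesis
    using assms(1,2) by (simp add: inj_on_eq_iff)
qed

lemma exchange_node:
  assumes \<alpha>: "\<alpha> \<in> groups" and h: "h \<in> parts" and y: "y \<in> node_part S h"
  obtains \<beta> where "\<beta> \<in> groups" "group_node S \<beta> h = y" "y \<in> node_group S \<beta>"
    "\<And>i. i \<in> parts - {h} \<Longrightarrow> group_node S \<beta> i = group_node S \<alpha> i"
proof -
  define f where "f = (group_node S \<alpha>)(h := y)"
  have f_part: "f i \<in> node_part S i" if "i \<in> parts" for i
    using that group_node_mem[OF \<alpha>] y by (auto simp: f_def)
  \<comment> \<open>A chosen node reveals its coordinate. This yields both the cardinality of the
    image and the uniqueness of its node in each part.\<close>
  have f_only: "i' = i" if "f i' \<in> node_part S i" "i \<in> parts" "i' \<in> parts" for i i'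
    using part_unique[OF that(3,2) f_part[OF that(3)] that(1)] .
  have "inj_on f parts"
    using f_only f_part by (metis inj_onI)
  then have "is_node_group S (f ` parts)"
    unfolding is_node_group_def
  proof (intro conjI ballI)
    show "f ` parts \<subseteq> nodes"
      using f_part part_subset_nodes by blast
    show "card (f ` parts) = num_parts S"
      using card_image[OF \<open>inj_on f parts\<close>] by simp
    fix i assume i: "i \<in> parts"
    show "\<exists>!k. k \<in> f ` parts \<inter> node_part S i"
      using f_part[OF i] f_only[OF _ i] i by (intro ex1I[of _ "f i"]) blast+
  qed
  then obtain \<beta> where \<beta>: "\<beta> \<in> groups" "node_group S \<beta> = f ` parts"
    using group_index by blast
  have "group_node S \<beta> i = f i" if "i \<in> parts" for i
    using group_node_eq[OF \<beta>(1) that] f_part \<beta>(2) that by blast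
  then show thesis
    using that[of \<beta>] \<beta> h by (auto simp: f_def)
qed

section \<open>Neighbouring groups and the number of exchanged IVs\<close>

lemma neighbours_iff:
  assumes "z \<in> node_part S h" "h \<in> parts"
  shows "l \<in> neighbours S z \<alpha> \<longleftrightarrow> l \<in> groups \<and> group_node S l h \<noteq> z \<and>
    (\<forall>i\<in>parts - {h}. group_node S l i = group_node S \<alpha> i)"
  \<comment> \<open>The existentially quantified axis in \<open>neighbours\<close> can only be
    \<open>h\<close>, since \<open>z\<close> lies in no other part.\<close>
  using assms part_unique unfolding neighbours_def by blast

text \<open>Reading off coordinate \<open>h\<close> is a bijection onto the nodes of the part other
  than \<open>z\<close>: all other coordinates are those of \<alpha>, and
  \<open>exchange_node\<close> realises every remaining value.\<close>

lemma card_neighbours: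
  assumes \<alpha>: "\<alpha> \<in> groups" and z: "z \<in> node_group S \<alpha>" "z \<in> node_part S h" and h: "h \<in> parts"
  shows "card (neighbours S z \<alpha>) = card (node_part S h) - 1"
proof -
  have "bij_betw (\<lambda>l. group_node S l h) (neighbours S z \<alpha>) (node_part S h - {z})"
    unfolding bij_betw_def
  proof
    show "inj_on (\<lambda>l. group_node S l h) (neighbours S z \<alpha>)"
    proof (rule inj_onI)
      fix l l' assume "l \<in> neighbours S z \<alpha>" "l' \<in> neighbours S z \<alpha>"
        "group_node S l h = group_node S l' h"
      then show "l = l'"
        unfolding neighbours_iff[OF z(2) h] by (metis DiffI group_eqI singletonD)
    qed
    show "(\<lambda>l. group_node S l h) ` neighbours S z \<alpha> = node_part S h - {z}"
    proof
      show "(\<lambda>l. group_node S l h) ` neighbours S z \<alpha> \<subseteq> node_part S h - {z}"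
        using group_node_mem(2)[OF _ h] neighbours_iff[OF z(2) h] by blast
      show "node_part S h - {z} \<subseteq> (\<lambda>l. group_node S l h) ` neighbours S z \<alpha>"
      proof
        fix y assume y: "y \<in> node_part S h - {z}"
        then obtain \<beta> where "\<beta> \<in> groups" "group_node S \<beta> h = y"
          "\<And>i. i \<in> parts - {h} \<Longrightarrow> group_node S \<beta> i = group_node S \<alpha> i"
          using exchange_node[OF \<alpha> h] by blast
        then show "y \<in> (\<lambda>l. group_node S l h) ` neighbours S z \<alpha>"
          using y by (intro image_eqI[of _ _ \<beta>]) (auto simp: neighbours_iff[OF z(2) h])
      qed
    qed
  qed
  then show ?thesis
    using bij_betw_same_card z(2) by fastforce
qed

text \<open>The number of neighbours, \<open>msize S p - 1\<close>, cancels the denominator in the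
  number of functions of \<open>z\<close>. The result no longer depends on the class of
  \<open>z\<close>, so the strings for different receivers match in length.\<close>

lemma card_iv_set:
  assumes \<alpha>: "\<alpha> \<in> groups" and z: "z \<in> node_group S \<alpha>"
  shows "card (iv_set S z \<alpha>) = eta1 S * eta2 S * lcmY S"
proof -
  obtain h where h: "h \<in> parts" "z \<in> node_part S h"
    using node_in_part group_subset_nodes[OF \<alpha>] z by blast
  then obtain p where p: "p \<in> {1..nclasses S}" "node_part S h \<subseteq> node_class S p"
    "card (node_part S h) = msize S p"
    using part_in_class by blast
  have m: "msize S p \<ge> 2"
    using msize p(1) by blast
  have nb: "neighbours S z \<alpha> \<subseteq> groups"
    by (auto simp: neighbours_def)
  have disj: "disjoint_family_on (file_batch S) groups"
    and batch: "\<And>l. l \<in> groups \<Longrightarrow> file_batch S l \<subseteq> {1..num_files S}"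
    and card_batch: "\<And>l. l \<in> groups \<Longrightarrow> card (file_batch S l) = eta1 S"
    using mapping by (auto simp: ng_file_mapping_def indexed_partition_def)
  have "iv_set S z \<alpha> = funs_of S z \<times> (\<Union>l\<in>neighbours S z \<alpha>. file_batch S l)"
    by (auto simp: iv_set_def)
  moreover have "card (\<Union>l\<in>neighbours S z \<alpha>. file_batch S l) =
      (\<Sum>l\<in>neighbours S z \<alpha>. card (file_batch S l))"
  proof (rule card_UN_disjoint)
    show "finite (neighbours S z \<alpha>)"
      using nb finite_subset by blast
    show "\<forall>l\<in>neighbours S z \<alpha>. finite (file_batch S l)"
      using nb batch finite_subset by blast
    show "\<forall>l\<in>neighbours S z \<alpha>. \<forall>l'\<in>neighbours S z \<alpha>. l \<noteq> l' \<longrightarrow>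
        file_batch S l \<inter> file_batch S l' = {}"
      using disj nb unfolding disjoint_family_on_def by blast
  qed
  moreover have "(\<Sum>l\<in>neighbours S z \<alpha>. card (file_batch S l)) = (msize S p - 1) * eta1 S"
    using nb card_batch card_neighbours[OF \<alpha> z h(2,1)] p(3)
    by (simp add: subset_iff)
  ultimately have "card (iv_set S z \<alpha>) = card (funs_of S z) * ((msize S p - 1) * eta1 S)"
    by (simp add: card_cartesian_product)
  \<comment> \<open>The assignment gives the number of functions as a real quotient; since
    \<open>msize S p\<close> is at least 2, its denominator can be cleared and the identity
    transferred to the naturals.\<close>
  moreover have "real (card (funs_of S z)) * real (msize S p - 1) = real (eta2 S) * real (lcmY S)"
  proof -
    have "real (card (funs_of S z)) = real (eta2 S) * real (lcmY S) / (real (msize S p) - 1)"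
      using assignment p h(2) unfolding function_assignment2_def by blast
    then show ?thesis
      using m by (simp add: of_nat_diff)
  qed
  then have "card (funs_of S z) * (msize S p - 1) = eta2 S * lcmY S"
    by (metis of_nat_eq_iff of_nat_mult)
  ultimately show ?thesis
    by (metis mult.assoc mult.commute)
qed

section \<open>Which IVs are locally available and which are delivered\<close>

lemma funs_of_subset: "k \<in> nodes \<Longrightarrow> funs_of S k \<subseteq> {1..nfuns S}"
  using assignment by (auto simp: function_assignment2_def indexed_partition_def)

lemma iv_set_subset:
  assumes "z \<in> nodes" shows "iv_set S z \<alpha> \<subseteq> {1..nfuns S} \<times> {1..num_files S}"
proof -
  have "neighbours S z \<alpha> \<subseteq> groups"
    by (auto simp: neighbours_def)
  moreover have "(\<Union>l\<in>groups. file_batch S l) = {1..num_files S}"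
    using mapping by (simp add: ng_file_mapping_def indexed_partition_def)
  ultimately show ?thesis
    using funs_of_subset[OF assms] unfolding iv_set_def by blast
qed

text \<open>Moving along the axis of \<open>z\<close> leaves the coordinate of \<open>k\<close>
  unchanged, so \<open>k\<close> belongs to every neighbouring group and stores its batch.\<close>

lemma iv_set_subset_computed:
  assumes \<alpha>: "\<alpha> \<in> groups" and k: "k \<in> node_group S \<alpha>" and z: "z \<in> node_group S \<alpha>" "z \<noteq> k"
  shows "iv_set S z \<alpha> \<subseteq> computed S k"
proof -
  obtain h where h: "h \<in> parts" "z \<in> node_part S h"
    using node_in_part group_subset_nodes[OF \<alpha>] z by blast
  obtain i where i: "i \<in> parts" "k \<in> node_part S i"
    using node_in_part group_subset_nodes[OF \<alpha>] k by blast
  \<comment> \<open>If both nodes lay in one part, each would be the unique node of \<alpha> there,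
    forcing \<open>z = k\<close>.\<close>
  have "i \<noteq> h"
    using group_node_eq[OF \<alpha>] h i k z by blast
  have "file_batch S l \<subseteq> files_at S k" if "l \<in> neighbours S z \<alpha>" for l
  proof -
    have l: "l \<in> groups" "group_node S l i = group_node S \<alpha> i"
      using that i \<open>i \<noteq> h\<close> by (auto simp: neighbours_iff[OF h(2,1)])
    then have "k \<in> node_group S l"
      using group_node_mem(1)[OF l(1) i(1)] group_node_eq[OF \<alpha> i(1) k i(2)] by simp
    then show ?thesis
      using l(1) by (auto simp: files_at_def)
  qed
  then show ?thesis
    using funs_of_subset group_subset_nodes[OF \<alpha>] z by (fastforce simp: iv_set_def computed_def)
qed

text \<open>A missing file lies in the batch of a group \<open>l\<close> avoiding \<open>k\<close>.
  Exchanging its node in the part of \<open>k\<close> for \<open>k\<close> gives a group \<alpha>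
  that has \<open>l\<close> as a neighbour along the axis of \<open>k\<close>.\<close>

lemma missing_file_delivered:
  assumes k: "k \<in> nodes" and j: "j \<in> {1..num_files S}" and i: "i \<in> funs_of S k"
    and not: "(i, j) \<notin> computed S k"
  obtains \<alpha> where "\<alpha> \<in> groups" "k \<in> node_group S \<alpha>" "(i, j) \<in> iv_set S k \<alpha>"
proof -
  obtain l where l: "l \<in> groups" "j \<in> file_batch S l"
    using mapping j unfolding ng_file_mapping_def indexed_partition_def by blast
  have kl: "k \<notin> node_group S l"
    using not l i funs_of_subset[OF k] by (auto simp: computed_def files_at_def)
  obtain h where h: "h \<in> parts" "k \<in> node_part S h"
    using node_in_part[OF k] by blast
  obtain \<alpha> where \<alpha>: "\<alpha> \<in> groups" "k \<in> node_group S \<alpha>"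
    "\<And>i. i \<in> parts - {h} \<Longrightarrow> group_node S \<alpha> i = group_node S l i"
    using exchange_node[OF l(1) h] by metis
  have "group_node S l h \<noteq> k"
    using group_node_mem(1)[OF l(1) h(1)] kl by blast
  then have "l \<in> neighbours S k \<alpha>"
    using \<alpha>(3) l(1) by (simp add: neighbours_iff[OF h(2,1)])
  then show thesis
    using that[OF \<alpha>(1,2)] i l(2) by (auto simp: iv_set_def)
qed

section \<open>Lengths of strings and segments\<close>

definition iv_lengths :: "(nat \<Rightarrow> nat \<Rightarrow> bool list) \<Rightarrow> bool" where
  "iv_lengths v \<longleftrightarrow> (\<forall>i\<in>{1..nfuns S}. \<forall>j\<in>{1..num_files S}. length (v i j) = ivbits S)"

text \<open>By \<open>card_iv_set\<close> a single length serves all groups and all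
  receivers.\<close>

abbreviation "seg_len \<equiv> ivbits S * (eta1 S * eta2 S * lcmY S) div (num_parts S - 1)"

lemma set_iv_order:
  "\<alpha> \<in> groups \<Longrightarrow> z \<in> node_group S \<alpha> \<Longrightarrow> set (iv_order S z \<alpha>) = iv_set S z \<alpha>"
  using shuffle by (simp add: shuffle_setup_def)

lemma length_iv_string:
  assumes v: "iv_lengths v" and \<alpha>: "\<alpha> \<in> groups" and z: "z \<in> node_group S \<alpha>"
  shows "length (iv_string S v z \<alpha>) = ivbits S * (eta1 S * eta2 S * lcmY S)"
proof -
  have zn: "z \<in> nodes"
    using group_subset_nodes[OF \<alpha>] z by blast
  have "length (iv_string S v z \<alpha>) = ivbits S * length (iv_order S z \<alpha>)"
    unfolding iv_string_def
    using v iv_set_subset[OF zn] set_iv_order[OF \<alpha> z]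
    by (intro length_concat_map_const) (auto simp: iv_lengths_def)
  moreover have "length (iv_order S z \<alpha>) = card (iv_set S z \<alpha>)"
    using shuffle \<alpha> z unfolding shuffle_setup_def by (metis distinct_card)
  ultimately show ?thesis
    using card_iv_set[OF \<alpha> z] by simp
qed

text \<open>The divisibility assumption makes the truncating quotient exact, so the segments cover
  the whole string.\<close>

lemma seg_len_mult:
  assumes "\<alpha> \<in> groups" "z \<in> node_group S \<alpha>"
  shows "(num_parts S - 1) * seg_len = ivbits S * (eta1 S * eta2 S * lcmY S)"
proof -
  have "(num_parts S - 1) dvd ivbits S * card (iv_set S z \<alpha>)"
    using shuffle assms by (simp add: shuffle_setup_def)
  then show ?thesis
    using card_iv_set[OF assms] by simp
qed

lemma segment_eq:
  assumes "iv_lengths v" "\<alpha> \<in> groups" "z \<in> node_group S \<alpha>"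
  shows "segment S v z \<alpha> \<sigma> =
    take seg_len (drop (seg_pos S z \<alpha> \<sigma> * seg_len) (iv_string S v z \<alpha>))"
  by (simp add: segment_def Let_def length_iv_string[OF assms])

lemma length_segment:
  assumes v: "iv_lengths v" and \<alpha>: "\<alpha> \<in> groups" and z: "z \<in> node_group S \<alpha>"
    and \<sigma>: "\<sigma> \<in> node_group S \<alpha> - {z}"
  shows "length (segment S v z \<alpha> \<sigma>) = seg_len"
proof -
  have "bij_betw (seg_pos S z \<alpha>) (node_group S \<alpha> - {z}) {..<num_parts S - 1}"
    using shuffle \<alpha> z by (simp add: shuffle_setup_def)
  \<comment> \<open>Positions start at 0, so the block ends at
    \<open>Suc (seg_pos S z \<alpha> \<sigma>) * seg_len\<close>, which must not exceed the string
    length.\<close>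
  then have "Suc (seg_pos S z \<alpha> \<sigma>) \<le> num_parts S - 1"
    using \<sigma> by (auto simp: Suc_le_eq dest: bij_betwE)
  then have "Suc (seg_pos S z \<alpha> \<sigma>) * seg_len \<le> (num_parts S - 1) * seg_len"
    by (rule mult_le_mono1)
  then show ?thesis
    unfolding segment_eq[OF v \<alpha> z] length_take length_drop length_iv_string[OF v \<alpha> z]
      seg_len_mult[OF \<alpha> z] mult_Suc
    by linarith
qed

section \<open>Encoding and decoding\<close>

lemma segment_cong:
  assumes "\<alpha> \<in> groups" "z \<in> node_group S \<alpha>" "\<And>i j. (i, j) \<in> iv_set S z \<alpha> \<Longrightarrow> v i j = v' i j"
  shows "segment S v z \<alpha> \<sigma> = segment S v' z \<alpha> \<sigma>"
proof -
  have "iv_string S v z \<alpha> = iv_string S v' z \<alpha>"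
    unfolding iv_string_def using assms set_iv_order
    by (intro arg_cong[of _ _ concat] map_cong) auto
  then show ?thesis
    by (simp add: segment_def)
qed

text \<open>Since \<sigma> is arbitrary, this serves both a sender forming its message and a
  receiver cancelling the segments meant for others.\<close>

lemma segment_known:
  assumes "\<alpha> \<in> groups" "k \<in> node_group S \<alpha>" "z \<in> node_group S \<alpha> - {k}"
    and "map_output S v k = map_output S v' k"
  shows "segment S v z \<alpha> \<sigma> = segment S v' z \<alpha> \<sigma>"
  using assms iv_set_subset_computed[of \<alpha> k z]
  by (intro segment_cong) (auto simp: map_output_eq_iff)

lemma message_known:
  assumes "\<alpha> \<in> groups" "k \<in> node_group S \<alpha>" and "map_output S v k = map_output S v' k"
  shows "message S v \<alpha> k = message S v' \<alpha> k"
proof -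
  have eq: "segment S v z \<alpha> k = segment S v' z \<alpha> k" if "z \<in> node_group S \<alpha> - {k}" for z
    using segment_known[OF assms(1,2) that assms(3)] .
  have "{z \<in> node_group S \<alpha> - {k}. segment S v z \<alpha> k ! b} =
      {z \<in> node_group S \<alpha> - {k}. segment S v' z \<alpha> k ! b}" for b
    using eq by auto
  moreover have "(\<lambda>z. length (segment S v z \<alpha> k)) ` (node_group S \<alpha> - {k}) =
      (\<lambda>z. length (segment S v' z \<alpha> k)) ` (node_group S \<alpha> - {k})"
    using eq by (intro image_cong) auto
  ultimately show ?thesis
    unfolding message_def xor_family_def by simp
qed

text \<open>Every summand other than that of \<open>z\<close> belongs to a string whose IVs
  \<open>z\<close> has computed, so only the segment of \<open>z\<close> is unknown.\<close>

lemma segment_decodable: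
  assumes \<alpha>: "\<alpha> \<in> groups" and k: "k \<in> node_group S \<alpha>" and z: "z \<in> node_group S \<alpha> - {k}"
    and v: "iv_lengths v" "iv_lengths v'"
    and known: "map_output S v z = map_output S v' z"
    and msg: "message S v \<alpha> k = message S v' \<alpha> k"
  shows "segment S v z \<alpha> k = segment S v' z \<alpha> k"
proof (rule xor_family_cancel[where A = "node_group S \<alpha> - {k}" and n = seg_len
      and f = "\<lambda>y. segment S v y \<alpha> k" and f' = "\<lambda>y. segment S v' y \<alpha> k"])
  show "segment S v y \<alpha> k = segment S v' y \<alpha> k" if "y \<in> node_group S \<alpha> - {k} - {z}" for y
    using segment_known[OF \<alpha> _ _ known, of y] z that by blast
  show "length (segment S v y \<alpha> k) = seg_len" "length (segment S v' y \<alpha> k) = seg_len"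
    if "y \<in> node_group S \<alpha> - {k}" for y
    using length_segment[OF _ \<alpha>, of _ y k] v k that by blast+
  show "xor_family (node_group S \<alpha> - {k}) (\<lambda>y. segment S v y \<alpha> k) =
      xor_family (node_group S \<alpha> - {k}) (\<lambda>y. segment S v' y \<alpha> k)"
    using msg unfolding message_def .
qed (use finite_group[OF \<alpha>] z in simp_all)

text \<open>The map \<open>seg_pos\<close> reaches every block position, so the segments of all
  senders together determine the string.\<close>

lemma iv_string_from_segments:
  assumes \<alpha>: "\<alpha> \<in> groups" and z: "z \<in> node_group S \<alpha>"
    and v: "iv_lengths v" "iv_lengths v'"
    and seg: "\<And>\<sigma>. \<sigma> \<in> node_group S \<alpha> - {z} \<Longrightarrow> segment S v z \<alpha> \<sigma> = segment S v' z \<alpha> \<sigma>"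
  shows "iv_string S v z \<alpha> = iv_string S v' z \<alpha>"
proof (rule eq_if_blocks_eq)
  show "length (iv_string S v z \<alpha>) = (num_parts S - 1) * seg_len"
    "length (iv_string S v' z \<alpha>) = (num_parts S - 1) * seg_len"
    using length_iv_string[OF _ \<alpha> z] v seg_len_mult[OF \<alpha> z] by simp_all
  fix n assume "n < num_parts S - 1"
  moreover have "bij_betw (seg_pos S z \<alpha>) (node_group S \<alpha> - {z}) {..<num_parts S - 1}"
    using shuffle \<alpha> z by (simp add: shuffle_setup_def)
  ultimately obtain \<sigma> where "\<sigma> \<in> node_group S \<alpha> - {z}" "seg_pos S z \<alpha> \<sigma> = n"
    by (metis bij_betw_def imageE lessThan_iff)
  then show "take seg_len (drop (n * seg_len) (iv_string S v z \<alpha>)) =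
      take seg_len (drop (n * seg_len) (iv_string S v' z \<alpha>))"
    using seg segment_eq[OF _ \<alpha> z] v by metis
qed

text \<open>An IV not computed at \<open>k\<close> lies in the string for \<open>k\<close> in some
  group. The messages of all other members of that group yield its segments, and the fixed IV length
  then isolates the single IV.\<close>

lemma needed_iv_recoverable:
  assumes k: "k \<in> nodes" and i: "i \<in> funs_of S k" and j: "j \<in> {1..num_files S}"
    and v: "iv_lengths v" "iv_lengths v'"
    and known: "map_output S v k = map_output S v' k"
    and rec: "received S v k = received S v' k"
  shows "v i j = v' i j"
proof (cases "(i, j) \<in> computed S k")
  case True
  then show ?thesis
    using known by (auto simp: map_output_eq_iff)
next
  case False
  then obtain \<alpha> where \<alpha>: "\<alpha> \<in> groups" "k \<in> node_group S \<alpha>" and ij: "(i, j) \<in> iv_set S k \<alpha>"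
    using missing_file_delivered[OF k j i] by blast
  have "segment S v k \<alpha> \<sigma> = segment S v' k \<alpha> \<sigma>" if "\<sigma> \<in> node_group S \<alpha> - {k}" for \<sigma>
  proof (rule segment_decodable[OF \<alpha>(1) _ _ v known])
    show "message S v \<alpha> \<sigma> = message S v' \<alpha> \<sigma>"
      using fun_cong[OF rec, of "(\<alpha>, \<sigma>)"] that \<alpha> by (auto simp: received_def)
  qed (use that \<alpha> in auto)
  then have "iv_string S v k \<alpha> = iv_string S v' k \<alpha>"
    using iv_string_from_segments[OF \<alpha> v] by blast
  \<comment> \<open>This form matches the function on pairs mapped in \<open>iv_string\<close>, as
    \<open>concat_map_eqD\<close> requires.\<close>
  then have "(case (i, j) of (i, j) \<Rightarrow> v i j) = (case (i, j) of (i, j) \<Rightarrow> v' i j)"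
    unfolding iv_string_def
  proof (rule concat_map_eqD)
    show "(i, j) \<in> set (iv_order S k \<alpha>)"
      using ij set_iv_order[OF \<alpha>] by simp
    show "length (case x of (i, j) \<Rightarrow> v i j) = length (case x of (i, j) \<Rightarrow> v' i j)"
      if "x \<in> set (iv_order S k \<alpha>)" for x
      using that set_iv_order[OF \<alpha>] iv_set_subset[OF k] v by (force simp: iv_lengths_def)
  qed
  then show ?thesis
    by simp
qed

section \<open>Correctness of the Shuffle phase and of the recovery of IVs\<close>

lemma iv_lengths_iv: "map_functions S g \<Longrightarrow> iv_lengths (iv g w)"
  by (simp add: map_functions_def iv_lengths_def iv_def)

lemma sends_own_ivs:
  assumes "map_functions S g" shows "sends_own_ivs S g"
  unfolding sends_own_ivs_def ex_function_of_iff
proof (intro ballI conjI allI impI)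
  fix \<alpha> k assume \<alpha>: "\<alpha> \<in> groups" and k: "k \<in> node_group S \<alpha>"
  show "message S (iv g w) \<alpha> k = message S (iv g w') \<alpha> k"
    if "map_output S (iv g w) k = map_output S (iv g w') k" for w w'
    using message_known[OF \<alpha> k that] .
  fix z assume z: "z \<in> node_group S \<alpha> - {k}"
  then show "iv_set S z \<alpha> \<subseteq> computed S k"
    using iv_set_subset_computed[OF \<alpha> k] by blast
  fix w z' assume z': "z' \<in> node_group S \<alpha> - {k}"
  have "length (segment S (iv g w) y \<alpha> k) = seg_len" if "y \<in> node_group S \<alpha> - {k}" for y
    using length_segment[OF iv_lengths_iv[OF assms] \<alpha>, of y k] k that by blast
  then show "length (segment S (iv g w) z \<alpha> k) = length (segment S (iv g w) z' \<alpha> k)"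
    using z z' by simp
qed

lemma decodes_segments:
  assumes "map_functions S g" shows "decodes_segments S g"
proof -
  have "\<exists>decoder. \<forall>w. segment S (iv g w) z \<alpha> k =
      decoder (map_output S (iv g w) z) (message S (iv g w) \<alpha> k)"
    if "\<alpha> \<in> groups" "k \<in> node_group S \<alpha>" "z \<in> node_group S \<alpha> - {k}" for \<alpha> k z
  proof -
    \<comment> \<open>\<open>ex_function_of_iff\<close> handles one source of knowledge, so map
      output and message are paired here and curried afterwards.\<close>
    have "\<exists>d. \<forall>w. segment S (iv g w) z \<alpha> k =
        d (map_output S (iv g w) z, message S (iv g w) \<alpha> k)"
      unfolding ex_function_of_iff
      using segment_decodable[OF that] iv_lengths_iv[OF assms] by blast
    then obtain d where "\<forall>w. segment S (iv g w) z \<alpha> k =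
        d (map_output S (iv g w) z, message S (iv g w) \<alpha> k)" ..
    then show ?thesis
      by (intro exI[of _ "\<lambda>m x. d (m, x)"])
  qed
  then show ?thesis
    unfolding decodes_segments_def by blast
qed

lemma has_needed_ivs:
  assumes "map_functions S g" shows "has_needed_ivs S g"
proof -
  have "\<exists>recover. \<forall>w. \<forall>i\<in>funs_of S k. \<forall>j\<in>{1..num_files S}.
      iv g w i j = recover (map_output S (iv g w) k) (received S (iv g w) k) i j"
    if k: "k \<in> nodes" for k
  proof -
    \<comment> \<open>With the default \<open>[]\<close>, equality of these functions means
      agreement on exactly the needed IVs, so one recovery function serves all \<open>i\<close> and
      \<open>j\<close>.\<close>
    let ?needed = "\<lambda>w i j. if i \<in> funs_of S k \<and> j \<in> {1..num_files S} then iv g w i j else []"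
    have "\<exists>d. \<forall>w. ?needed w = d (map_output S (iv g w) k, received S (iv g w) k)"
      unfolding ex_function_of_iff
      using needed_iv_recoverable[OF k] iv_lengths_iv[OF assms]
      by (auto simp: fun_eq_iff simp del: atLeastAtMost_iff)
    then obtain d where d: "\<And>w. ?needed w = d (map_output S (iv g w) k, received S (iv g w) k)"
      by blast
    have "iv g w i j = d (map_output S (iv g w) k, received S (iv g w) k) i j"
      if "i \<in> funs_of S k" "j \<in> {1..num_files S}" for w i j
      unfolding d[symmetric] using that by simp
    then show ?thesis
      by (intro exI[of _ "\<lambda>m x. d (m, x)"]) blast
  qed
  then show ?thesis
    unfolding has_needed_ivs_def by blast
qed

end

theorem mainTheorem4:
  fixes S :: hc_scheme and g :: "nat \<Rightarrow> nat \<Rightarrow> 'f \<Rightarrow> bool list"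
  assumes "nclasses S \<ge> 1"
    and "\<forall>p\<in>{1..nclasses S}. rdim S p \<ge> 1"
    and "\<forall>p\<in>{1..nclasses S}. msize S p \<ge> 2"
    and "eta1 S \<ge> 1" and "eta2 S \<ge> 1" and "ivbits S \<ge> 1"
    and "num_parts S \<ge> 2"
    and "node_grouping2 S"
    and "ng_file_mapping S"
    and "function_assignment2 S"
    and "shuffle_setup S"
    and "map_functions S g"
  shows "maps_own_files S g \<and> sends_own_ivs S g \<and> decodes_segments S g \<and> has_needed_ivs S g"
proof -
  interpret hypercuboid_scheme S
    by unfold_locales (use assms in auto)
  show ?thesis
    using maps_own_files sends_own_ivs decodes_segments has_needed_ivs assms(12) by blast
qed

end
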